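(* Let $|\phi\rangle_{ABCD}$ be a normalized pure state of four qubits, with reduced density matrices $\rho_{BCD}=\mathrm{Tr}_A|\phi\rangle\langle\phi|$ and $\rho_{CD}=\mathrm{Tr}_{AB}|\phi\rangle\langle\phi|$. Then $$\tau_{(A)BCD}^2+\tau_3^2(\rho_{BCD})\le C_a^2(\rho_{CD})-C^2(\rho_{CD})=\tau_3^2(|\phi\rangle_{[AB]CD}).$$
   Context: Three-tangle of pure states: for a three-qubit pure state $|\psi\rangle=\sum_{i,j,k=0}^1 a_{ijk}|ijk\rangle$ let $\mu_3(|\psi\rangle)=4|d_1-2d_2+4d_3|$, where $d_1=a_{000}^2a_{111}^2+a_{001}^2a_{110}^2+a_{010}^2a_{101}^2+a_{100}^2a_{011}^2$, $d_2=a_{000}a_{111}a_{011}a_{100}+a_{000}a_{111}a_{101}a_{010}+a_{000}a_{111}a_{110}a_{001}+a_{011}a_{100}a_{101}a_{010}+a_{011}a_{100}a_{110}a_{001}+a_{101}a_{010}a_{110}a_{001}$, $d_3=a_{000}a_{110}a_{101}a_{011}+a_{111}a_{001}a_{010}a_{100}$. Set $\tau_3(|\psi\rangle)=\sqrt{\mu_3(|\psi\rangle)}$. Mixed states: for a three-qubit density matrix $\rho$, $\tau_3(\rho)=\min_{\{p_i,\pi_i\}}\sum_i p_i\tau_3(\pi_i)$ and $\tau_a(\rho)=\max_{\{p_i,\pi_i\}}\sum_i p_i\tau_3(\pi_i)$ (3-tangle of assistance), where the min and max run over all finite decompositions $\rho=\sum_i p_i\pi_i$ with $p_i\ge0$,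 $\sum_i p_i=1$, and $\pi_i$ (projectors onto) normalized pure states. Define $\tau_{(A)BCD}=\sqrt{\tau_a^2(\rho_{BCD})-\tau_3^2(\rho_{BCD})}$ (the bracket indicates that subsystem $A$ is traced out). Concurrence: for a two-qubit pure state $|\chi\rangle=\sum_{i,j=0}^1 b_{ij}|ij\rangle$, $C(|\chi\rangle)=2|b_{00}b_{11}-b_{01}b_{10}|$. For a two-qubit density matrix $\sigma$, the concurrence $C(\sigma)$ is the minimum and the concurrence of assistance $C_a(\sigma)$ is the maximum of $\sum_i p_iC(|\chi_i\rangle)$ over all finite decompositions $\sigma=\sum_i p_i|\chi_i\rangle\langle\chi_i|$ into normalized pure states with $p_i\geq 0$, $\sum_i p_i=1$. The quantity $\tau_3(|\phi\rangle_{[AB]CD})$ denotes the 3-tangle of $|\phi\rangle$ regarded as a tripartite $(4\otimes2\otimes2)$-dimensional state with $A$ and $B$ considered as one party; it is given by $\tau_3(|\phi\rangle_{[AB]CD})=\sqrt{C_a^2(\rho_{CD})-C^2(\rho_{CD})}$. *)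

theory Defs
  imports "HOL-Analysis.Analysis"
begin

text \<open>
  A pure state of finitely many qubits is a vector of amplitudes indexed by a tuple over the
  two-element type \<open>2\<close>, whose elements are \<open>0\<close> and \<open>1\<close>: a three-qubit
  state has type \<open>complex ^ (2 \<times> 2 \<times> 2)\<close>, and its amplitude \<open>a_ijk\<close>
  is \<open>\<psi> $ (i, j, k)\<close>.  The vector norm of \<open>HOL-Analysis\<close> is the Hilbert
  space norm, so a state is normalized iff \<open>norm \<psi> = 1\<close>.
\<close>

definition proj :: "complex ^ 'n \<Rightarrow> complex ^ 'n ^ 'n" where
  "proj \<psi> = (\<chi> i j. \<psi> $ i * cnj (\<psi> $ j))"

definition ptrace_fst :: "complex ^ ('a::finite \<times> 'b::finite) ^ ('a \<times> 'b) \<Rightarrow> complex ^ 'b ^ 'b" where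
  "ptrace_fst \<rho> = (\<chi> i j. \<Sum>a\<in>UNIV. \<rho> $ (a, i) $ (a, j))"

definition mu3 :: "complex ^ (2 \<times> 2 \<times> 2) \<Rightarrow> real" where
  "mu3 \<psi> =
    (let a = (\<lambda>i j k. \<psi> $ (i, j, k));
         d1 = (a 0 0 0)\<^sup>2 * (a 1 1 1)\<^sup>2 + (a 0 0 1)\<^sup>2 * (a 1 1 0)\<^sup>2
            + (a 0 1 0)\<^sup>2 * (a 1 0 1)\<^sup>2 + (a 1 0 0)\<^sup>2 * (a 0 1 1)\<^sup>2;
         d2 = a 0 0 0 * a 1 1 1 * a 0 1 1 * a 1 0 0
            + a 0 0 0 * a 1 1 1 * a 1 0 1 * a 0 1 0
            + a 0 0 0 * a 1 1 1 * a 1 1 0 * a 0 0 1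
            + a 0 1 1 * a 1 0 0 * a 1 0 1 * a 0 1 0
            + a 0 1 1 * a 1 0 0 * a 1 1 0 * a 0 0 1
            + a 1 0 1 * a 0 1 0 * a 1 1 0 * a 0 0 1;
         d3 = a 0 0 0 * a 1 1 0 * a 1 0 1 * a 0 1 1
            + a 1 1 1 * a 0 0 1 * a 0 1 0 * a 1 0 0
     in 4 * cmod (d1 - 2 * d2 + 4 * d3))"

definition tau3_pure :: "complex ^ (2 \<times> 2 \<times> 2) \<Rightarrow> real" where
  "tau3_pure \<psi> = sqrt (mu3 \<psi>)"

definition concurrence_pure :: "complex ^ (2 \<times> 2) \<Rightarrow> real" where
  "concurrence_pure \<psi> = 2 * cmod (\<psi> $ (0, 0) * \<psi> $ (1, 1) - \<psi> $ (0, 1) * \<psi> $ (1, 0))"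

definition decomposition_averages ::
  "(complex ^ 'n \<Rightarrow> real) \<Rightarrow> complex ^ 'n ^ 'n \<Rightarrow> real set" where
  "decomposition_averages f \<rho> =
    {t. \<exists>(m::nat) (p :: nat \<Rightarrow> real) (\<psi> :: nat \<Rightarrow> complex ^ 'n).
          (\<forall>i<m. 0 \<le> p i \<and> norm (\<psi> i) = 1) \<and> (\<Sum>i<m. p i) = 1 \<and>
          \<rho> = (\<Sum>i<m. p i *\<^sub>R proj (\<psi> i)) \<and>
          t = (\<Sum>i<m. p i * f (\<psi> i))}"

text \<open>
  The optimum over all decompositions is a genuine minimum or maximum, not an infimum or supremum:
  for a density matrix \<open>\<rho>\<close> and continuous \<open>f\<close> it is attained by compactness.
\<close>

definition roof_min :: "(complex ^ 'n \<Rightarrow> real) \<Rightarrow> complex ^ 'n ^ 'n \<Rightarrow> real" where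
  "roof_min f \<rho> = (LEAST t. t \<in> decomposition_averages f \<rho>)"

definition roof_max :: "(complex ^ 'n \<Rightarrow> real) \<Rightarrow> complex ^ 'n ^ 'n \<Rightarrow> real" where
  "roof_max f \<rho> = (GREATEST t. t \<in> decomposition_averages f \<rho>)"

definition tau3 :: "complex ^ (2 \<times> 2 \<times> 2) ^ (2 \<times> 2 \<times> 2) \<Rightarrow> real" where
  "tau3 = roof_min tau3_pure"

definition tau_assist :: "complex ^ (2 \<times> 2 \<times> 2) ^ (2 \<times> 2 \<times> 2) \<Rightarrow> real" where
  "tau_assist = roof_max tau3_pure"

definition concurrence :: "complex ^ (2 \<times> 2) ^ (2 \<times> 2) \<Rightarrow> real" where
  "concurrence = roof_min concurrence_pure"

definition concurrence_assist :: "complex ^ (2 \<times> 2) ^ (2 \<times> 2) \<Rightarrow> real" where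
  "concurrence_assist = roof_max concurrence_pure"

text \<open>The index of a four-qubit state is \<open>(A, B, C, D) = (A, (B, (C, D)))\<close>.\<close>

definition rho_BCD :: "complex ^ (2 \<times> 2 \<times> 2 \<times> 2) \<Rightarrow> complex ^ (2 \<times> 2 \<times> 2) ^ (2 \<times> 2 \<times> 2)" where
  "rho_BCD \<phi> = ptrace_fst (proj \<phi>)"

definition rho_CD :: "complex ^ (2 \<times> 2 \<times> 2 \<times> 2) \<Rightarrow> complex ^ (2 \<times> 2) ^ (2 \<times> 2)" where
  "rho_CD \<phi> = ptrace_fst (ptrace_fst (proj \<phi>))"

definition tau_A_BCD :: "complex ^ (2 \<times> 2 \<times> 2 \<times> 2) \<Rightarrow> real" where
  "tau_A_BCD \<phi> = sqrt ((tau_assist (rho_BCD \<phi>))\<^sup>2 - (tau3 (rho_BCD \<phi>))\<^sup>2)"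

definition tau3_AB_C_D :: "complex ^ (2 \<times> 2 \<times> 2 \<times> 2) \<Rightarrow> real" where
  "tau3_AB_C_D \<phi> = sqrt ((concurrence_assist (rho_CD \<phi>))\<^sup>2 - (concurrence (rho_CD \<phi>))\<^sup>2)"

end

(*
  For a pure three-qubit state with reduced two-qubit state sigma, a Takagi diagonalisation of the
  2x2 matrix of the spin-flip form provides two decompositions of sigma whose average concurrences
  a >= c satisfy tau_3^2 = a^2 - c^2.  Given a decomposition of rho_BCD with weights p_i that
  attains tau_a, mixing these gives two decompositions of rho_CD, and Cauchy-Schwarz applied to
  sqrt (a_i - c_i) and sqrt (a_i + c_i) yields
    (sum p_i tau_3(pi_i))^2 <= (sum p_i a_i)^2 - (sum p_i c_i)^2 <= C_a^2 - C^2.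
  The optima are attained because the averages form a slice of the convex hull of a compact set.
*)
theory Submission
  imports Defs
begin

subsection \<open>Convex and concave roofs\<close>

lemma decomposition_averagesE:
  assumes "t \<in> decomposition_averages f \<rho>"
  obtains m :: nat and p \<psi> where "\<forall>i<m. 0 \<le> p i \<and> norm (\<psi> i) = 1" "(\<Sum>i<m. p i) = 1"
    "\<rho> = (\<Sum>i<m. p i *\<^sub>R proj (\<psi> i))" "t = (\<Sum>i<m. p i * f (\<psi> i))"
  using assms that unfolding decomposition_averages_def by blast

text \<open>Pairing each projector with its value under \<open>f\<close> turns an ensemble into a
  convex combination of points of the graph of \<open>f\<close>. Compactness and mixing of averages
  then become facts about one convex hull.\<close>

lemma decomposition_averages_eq_slice:
  "decomposition_averages f \<rho> = {t. (\<rho>, t) \<in> convex hull ((\<lambda>\<psi>. (proj \<psi>, f \<psi>)) ` sphere 0 1)}"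
    (is "_ = {t. (\<rho>, t) \<in> convex hull ?S}")
proof (intro set_eqI iffI)
  fix t assume "t \<in> decomposition_averages f \<rho>"
  then obtain m :: nat and p \<psi> where m: "\<forall>i<m. 0 \<le> p i \<and> norm (\<psi> i) = 1" "(\<Sum>i<m. p i) = 1"
      "\<rho> = (\<Sum>i<m. p i *\<^sub>R proj (\<psi> i))" "t = (\<Sum>i<m. p i * f (\<psi> i))"
    by (rule decomposition_averagesE)
  have "(\<Sum>i<m. p i *\<^sub>R (proj (\<psi> i), f (\<psi> i))) \<in> convex hull ?S"
  proof (rule convex_sum)
    show "(proj (\<psi> i), f (\<psi> i)) \<in> convex hull ?S" if "i \<in> {..<m}" for i
      using m(1) that by (intro hull_inc imageI) simp
  qed (use m in auto)
  moreover have "(\<Sum>i<m. p i *\<^sub>R (proj (\<psi> i), f (\<psi> i))) = (\<rho>, t)"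
    unfolding m(3,4) by (simp add: prod_eq_iff fst_sum snd_sum)
  ultimately show "t \<in> {t. (\<rho>, t) \<in> convex hull ?S}" by simp
next
  fix t assume "t \<in> {t. (\<rho>, t) \<in> convex hull ?S}"
  then obtain k u x where k: "\<forall>i\<in>{1::nat..k}. 0 \<le> u i \<and> x i \<in> ?S" "sum u {1..k} = 1"
      "(\<Sum>i=1..k. u i *\<^sub>R x i) = (\<rho>, t)"
    unfolding convex_hull_indexed by auto
  have "\<forall>i\<in>{1..k}. \<exists>\<psi>. norm \<psi> = 1 \<and> x i = (proj \<psi>, f \<psi>)"
  proof
    fix i assume "i \<in> {1..k}"
    with k(1) have "x i \<in> ?S" by blast
    then show "\<exists>\<psi>. norm \<psi> = 1 \<and> x i = (proj \<psi>, f \<psi>)" by auto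
  qed
  then obtain \<psi> where \<psi>: "\<And>i. i \<in> {1..k} \<Longrightarrow> norm (\<psi> i) = 1 \<and> x i = (proj (\<psi> i), f (\<psi> i))"
    by metis
  have "(\<Sum>i=1..k. u i *\<^sub>R x i) = (\<Sum>i=1..k. u i *\<^sub>R (proj (\<psi> i), f (\<psi> i)))"
    using \<psi> by (intro sum.cong) auto
  then have "\<rho> = (\<Sum>i=1..k. u i *\<^sub>R proj (\<psi> i))" "t = (\<Sum>i=1..k. u i * f (\<psi> i))"
    using k(3) by (simp_all add: prod_eq_iff fst_sum snd_sum)
  \<comment> \<open>Hull combinations are indexed from 1 and ensembles from 0, hence the shift by
    \<open>Suc\<close>.\<close>
  moreover have "\<forall>i<k. 0 \<le> u (Suc i) \<and> norm (\<psi> (Suc i)) = 1"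
    using k(1) \<psi> by (metis Suc_leI atLeastAtMost_iff le_add1 plus_1_eq_Suc)
  ultimately show "t \<in> decomposition_averages f \<rho>"
    unfolding decomposition_averages_def mem_Collect_eq
    using k(2)
    by (intro exI[of _ k] exI[of _ "\<lambda>i. u (Suc i)"] exI[of _ "\<lambda>i. \<psi> (Suc i)"])
       (simp only: One_nat_def sum.atLeast1_atMost_eq simp_thms)
qed

lemma continuous_on_proj: "continuous_on S proj"
  unfolding proj_def by (intro continuous_on_vec_lambda continuous_intros)

text \<open>The number of terms is unbounded, so compactness comes from the hull: in finite
  dimension the hull of the compact graph is compact, and the averages are the projection of its
  fibre over \<open>\<rho>\<close>.\<close>

lemma compact_decomposition_averages:
  fixes f :: "complex ^ 'n \<Rightarrow> real"
  assumes "continuous_on (sphere 0 1) f"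
  shows "compact (decomposition_averages f \<rho>)"
proof -
  let ?H = "convex hull ((\<lambda>\<psi>. (proj \<psi>, f \<psi>)) ` sphere 0 1)"
  have "compact ?H"
    using assms
    by (intro compact_convex_hull compact_continuous_image continuous_intros continuous_on_proj) auto
  then have "compact (?H \<inter> {\<rho>} \<times> UNIV)"
    by (intro compact_Int_closed closed_Times) auto
  then have "compact (snd ` (?H \<inter> {\<rho>} \<times> UNIV))"
    by (intro compact_continuous_image continuous_on_snd continuous_on_id)
  moreover have "snd ` (?H \<inter> {\<rho>} \<times> UNIV) = decomposition_averages f \<rho>"
    unfolding decomposition_averages_eq_slice by force
  ultimately show ?thesis by simp
qed

text \<open>\<open>LEAST\<close> on the reals is informative only once a minimum is known to exist;
  compactness provides it.\<close>

lemma roof_min_attained: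
  assumes "continuous_on (sphere 0 1) f" "decomposition_averages f \<rho> \<noteq> {}"
  shows "roof_min f \<rho> \<in> decomposition_averages f \<rho>"
    and "t \<in> decomposition_averages f \<rho> \<Longrightarrow> roof_min f \<rho> \<le> t"
proof -
  obtain s where s: "s \<in> decomposition_averages f \<rho>" "\<forall>t\<in>decomposition_averages f \<rho>. s \<le> t"
    using compact_attains_inf[OF compact_decomposition_averages] assms by metis
  have "roof_min f \<rho> = s"
    unfolding roof_min_def using s by (intro Least_equality) auto
  with s show "roof_min f \<rho> \<in> decomposition_averages f \<rho>"
    and "t \<in> decomposition_averages f \<rho> \<Longrightarrow> roof_min f \<rho> \<le> t" by auto
qed

lemma roof_max_attained:
  assumes "continuous_on (sphere 0 1) f" "decomposition_averages f \<rho> \<noteq> {}"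
  shows "roof_max f \<rho> \<in> decomposition_averages f \<rho>"
    and "t \<in> decomposition_averages f \<rho> \<Longrightarrow> t \<le> roof_max f \<rho>"
proof -
  obtain s where s: "s \<in> decomposition_averages f \<rho>" "\<forall>t\<in>decomposition_averages f \<rho>. t \<le> s"
    using compact_attains_sup[OF compact_decomposition_averages] assms by metis
  have "roof_max f \<rho> = s"
    unfolding roof_max_def using s by (intro Greatest_equality) auto
  with s show "roof_max f \<rho> \<in> decomposition_averages f \<rho>"
    and "t \<in> decomposition_averages f \<rho> \<Longrightarrow> t \<le> roof_max f \<rho>" by auto
qed

lemma decomposition_averages_nonneg:
  assumes "\<And>\<psi>. 0 \<le> f \<psi>" "t \<in> decomposition_averages f \<rho>"
  shows "0 \<le> t"
  using assms unfolding decomposition_averages_def by (auto intro!: sum_nonneg)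

text \<open>Convexity of the hull replaces an explicit concatenation of ensembles.\<close>

lemma decomposition_averages_mix:
  assumes "finite I" "\<And>i. i \<in> I \<Longrightarrow> 0 \<le> p i" "(\<Sum>i\<in>I. p i) = 1"
    and "\<And>i. i \<in> I \<Longrightarrow> t i \<in> decomposition_averages f (\<sigma> i)"
  shows "(\<Sum>i\<in>I. p i * t i) \<in> decomposition_averages f (\<Sum>i\<in>I. p i *\<^sub>R \<sigma> i)"
proof -
  let ?H = "convex hull ((\<lambda>\<psi>. (proj \<psi>, f \<psi>)) ` sphere 0 1)"
  have "(\<Sum>i\<in>I. p i *\<^sub>R (\<sigma> i, t i)) \<in> ?H"
    using assms by (intro convex_sum) (auto simp: decomposition_averages_eq_slice)
  moreover have "(\<Sum>i\<in>I. p i *\<^sub>R (\<sigma> i, t i)) = (\<Sum>i\<in>I. p i *\<^sub>R \<sigma> i, \<Sum>i\<in>I. p i * t i)"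
    by (simp add: prod_eq_iff fst_sum snd_sum)
  ultimately show ?thesis by (simp add: decomposition_averages_eq_slice)
qed

section \<open>Unnormalised ensembles\<close>

lemma proj_scaleR: "proj (r *\<^sub>R \<psi>) = r\<^sup>2 *\<^sub>R proj \<psi>"
  by (simp add: vec_eq_iff proj_def power2_eq_square)

lemma trace_proj: "(\<Sum>i\<in>UNIV. proj \<psi> $ i $ i) = of_real ((norm \<psi>)\<^sup>2)"
proof -
  have "(norm \<psi>)\<^sup>2 = (\<Sum>i\<in>UNIV. (norm (\<psi> $ i))\<^sup>2)"
    by (simp add: norm_vec_def L2_set_def sum_nonneg)
  then show ?thesis
    unfolding proj_def by (simp only: of_real_sum complex_norm_square vec_lambda_beta)
qed

text \<open>Both sides are the trace of the same matrix. This carries normalisation over from one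
  ensemble to another.\<close>

lemma sum_norm_proj_eq:
  assumes "(\<Sum>i\<in>I. proj (v i)) = (\<Sum>j\<in>J. proj (w j))"
  shows "(\<Sum>i\<in>I. (norm (v i))\<^sup>2) = (\<Sum>j\<in>J. (norm (w j))\<^sup>2)"
proof -
  have "complex_of_real (\<Sum>i\<in>K. (norm (u i))\<^sup>2) = (\<Sum>n\<in>UNIV. (\<Sum>i\<in>K. proj (u i)) $ n $ n)"
    for K and u :: "_ \<Rightarrow> complex ^ 'a"
    by (simp add: sum.swap[of _ K] flip: trace_proj del: of_real_power)
  from this[of v I] this[of w J] assms show ?thesis
    by (metis of_real_eq_iff)
qed

text \<open>Homogeneity of degree 2 lets the weight \<open>(norm (v i))\<^sup>2\<close> be absorbed
  into the vector, so weights need not be tracked in explicit ensembles.\<close>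

lemma sum_in_decomposition_averages:
  fixes v :: "'i \<Rightarrow> complex ^ 'n"
  assumes hom: "\<And>r \<psi>. f (r *\<^sub>R \<psi>) = r\<^sup>2 * f \<psi>"
    and "finite I" "(\<Sum>i\<in>I. (norm (v i))\<^sup>2) = 1"
  shows "(\<Sum>i\<in>I. f (v i)) \<in> decomposition_averages f (\<Sum>i\<in>I. proj (v i))"
proof -
  let ?e = "axis undefined 1 :: complex ^ 'n"
  \<comment> \<open>A zero vector has weight 0, so any unit vector can stand in for its
    direction.\<close>
  define u where "u i = (if v i = 0 then ?e else inverse (norm (v i)) *\<^sub>R v i)" for i
  have u: "norm (u i) = 1" "v i = norm (v i) *\<^sub>R u i" for i
    by (auto simp: u_def)
  have fv: "f (v i) = (norm (v i))\<^sup>2 * f (u i)" "proj (v i) = (norm (v i))\<^sup>2 *\<^sub>R proj (u i)" for i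
    by (metis hom u(2)) (metis proj_scaleR u(2))
  have "f (u i) \<in> decomposition_averages f (proj (u i))" for i
    unfolding decomposition_averages_eq_slice mem_Collect_eq using u(1) by (intro hull_inc imageI) simp
  then have "(\<Sum>i\<in>I. (norm (v i))\<^sup>2 * f (u i))
      \<in> decomposition_averages f (\<Sum>i\<in>I. (norm (v i))\<^sup>2 *\<^sub>R proj (u i))"
    using assms by (intro decomposition_averages_mix) auto
  then show ?thesis by (simp add: fv)
qed

subsection \<open>Partial traces\<close>

text \<open>The unnormalised state of the second subsystem when the first is found in basis state
  \<open>a\<close>.\<close>

definition slice :: "complex ^ ('a::finite \<times> 'b::finite) \<Rightarrow> 'a \<Rightarrow> complex ^ 'b" where
  "slice \<psi> a = (\<chi> i. \<psi> $ (a, i))"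

lemma ptrace_fst_proj: "ptrace_fst (proj \<psi>) = (\<Sum>a\<in>UNIV. proj (slice \<psi> a))"
  by (simp add: vec_eq_iff ptrace_fst_def proj_def slice_def)

lemma ptrace_fst_sum: "ptrace_fst (\<Sum>i\<in>I. p i *\<^sub>R \<rho> i) = (\<Sum>i\<in>I. p i *\<^sub>R ptrace_fst (\<rho> i))"
  by (simp add: vec_eq_iff ptrace_fst_def scaleR_sum_right sum.swap[of _ I])

lemma sum_norm_slice: "(\<Sum>a\<in>UNIV. (norm (slice \<psi> a))\<^sup>2) = (norm \<psi>)\<^sup>2"
  by (simp add: norm_vec_def L2_set_def sum_nonneg slice_def sum.cartesian_product)

subsection \<open>Concurrence and three-tangle\<close>

lemma continuous_on_tau3_pure: "continuous_on S tau3_pure"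
  unfolding tau3_pure_def mu3_def Let_def by (intro continuous_intros)

lemma continuous_on_concurrence_pure: "continuous_on S concurrence_pure"
  unfolding concurrence_pure_def by (intro continuous_intros)

lemma concurrence_pure_scaleR: "concurrence_pure (r *\<^sub>R \<psi>) = r\<^sup>2 * concurrence_pure \<psi>"
proof -
  have "(r *\<^sub>R \<psi>) $ (0, 0) * (r *\<^sub>R \<psi>) $ (1, 1) - (r *\<^sub>R \<psi>) $ (0, 1) * (r *\<^sub>R \<psi>) $ (1, 0)
      = of_real (r\<^sup>2) * (\<psi> $ (0, 0) * \<psi> $ (1, 1) - \<psi> $ (0, 1) * \<psi> $ (1, 0))"
    by (simp add: scaleR_conv_of_real[where 'a = complex] power2_eq_square algebra_simps)
  then show ?thesis
    unfolding concurrence_pure_def by (simp only: norm_mult norm_of_real) simp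
qed

text \<open>Up to sign the form v^T (sigma_y tensor sigma_y) w of the spin flip. It is free of
  conjugation, hence symmetric and bilinear.\<close>

definition spin_form :: "complex ^ (2 \<times> 2) \<Rightarrow> complex ^ (2 \<times> 2) \<Rightarrow> complex" where
  "spin_form v w = v $ (0, 0) * w $ (1, 1) + v $ (1, 1) * w $ (0, 0)
                 - v $ (0, 1) * w $ (1, 0) - v $ (1, 0) * w $ (0, 1)"

lemma spin_form_combine:
  "spin_form (a *s v + b *s w) (c *s v + d *s w)
     = a * c * spin_form v v + (a * d + b * c) * spin_form v w + b * d * spin_form w w"
  by (simp add: spin_form_def algebra_simps)

lemma concurrence_pure_eq: "concurrence_pure v = cmod (spin_form v v)"
proof -
  have "spin_form v v = 2 * (v $ (0, 0) * v $ (1, 1) - v $ (0, 1) * v $ (1, 0))"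
    by (simp add: spin_form_def algebra_simps)
  then show ?thesis by (simp only: concurrence_pure_def norm_mult norm_numeral)
qed

text \<open>The polynomial in \<open>mu3\<close> is Cayley's hyperdeterminant, which is minus the
  determinant of the 2x2 Gram matrix of \<open>spin_form\<close> on the two slices; the modulus
  hides the sign.\<close>

lemma mu3_eq_det:
  "mu3 \<psi> = 4 * cmod (spin_form (slice \<psi> 0) (slice \<psi> 0) * spin_form (slice \<psi> 1) (slice \<psi> 1)
                    - (spin_form (slice \<psi> 0) (slice \<psi> 1))\<^sup>2)"
  unfolding mu3_def Let_def spin_form_def slice_def
  by (subst norm_minus_cancel[symmetric], rule arg_cong[where f = "\<lambda>z. 4 * cmod z"])
    (simp add: power2_eq_square algebra_simps)

lemma mu3_nonneg: "0 \<le> mu3 \<psi>"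
  by (simp add: mu3_eq_det)

lemma mu3_scaleR: "mu3 (r *\<^sub>R \<psi>) = (r\<^sup>2)\<^sup>2 * mu3 \<psi>"
proof -
  have "spin_form (slice (r *\<^sub>R \<psi>) i) (slice (r *\<^sub>R \<psi>) j)
      = of_real (r\<^sup>2) * spin_form (slice \<psi> i) (slice \<psi> j)" for i j
    by (simp add: spin_form_def slice_def scaleR_conv_of_real[where 'a = complex] power2_eq_square algebra_simps)
  then have "mu3 (r *\<^sub>R \<psi>) = 4 * cmod (of_real ((r\<^sup>2)\<^sup>2) *
     (spin_form (slice \<psi> 0) (slice \<psi> 0) * spin_form (slice \<psi> 1) (slice \<psi> 1)
                    - (spin_form (slice \<psi> 0) (slice \<psi> 1))\<^sup>2))"
    unfolding mu3_eq_det by (simp add: power2_eq_square algebra_simps)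
  also have "\<dots> = (r\<^sup>2)\<^sup>2 * mu3 \<psi>"
    unfolding mu3_eq_det norm_mult norm_of_real by simp
  finally show ?thesis .
qed

lemma tau3_pure_scaleR: "tau3_pure (r *\<^sub>R \<psi>) = r\<^sup>2 * tau3_pure \<psi>"
  by (simp only: tau3_pure_def mu3_scaleR real_sqrt_mult real_sqrt_abs abs_power2)

section \<open>Rotating two-member ensembles and diagonalising the spin form\<close>

lemma proj_unitary_mix:
  assumes "(cmod a)\<^sup>2 + (cmod b)\<^sup>2 = 1"
  shows "proj (a *s v + b *s w) + proj (- cnj b *s v + cnj a *s w) = proj v + proj w"
proof -
  have "a * cnj a + b * cnj b = 1"
    using assms by (metis complex_norm_square of_real_1 of_real_add)
  then show ?thesis
    by (simp add: vec_eq_iff proj_def) algebra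
qed

text \<open>The left side of the equation is the off-diagonal entry of the symmetric matrix with
  rows \<open>(P, R)\<close> and \<open>(R, Q)\<close> after the rotation of
  \<open>proj_unitary_mix\<close>. A phase reduces its vanishing to a real equation for an angle,
  whose two sides compare oppositely at 0 and \<open>pi/2\<close>.\<close>

lemma takagi_2x2:
  fixes P Q R :: complex
  obtains a b where "(cmod a)\<^sup>2 + (cmod b)\<^sup>2 = 1"
    and "- a * cnj b * P + (a * cnj a - b * cnj b) * R + b * cnj a * Q = 0"
proof (cases "R = 0")
  case True
  then show ?thesis by (intro that[of 1 0]) auto
next
  case False
  \<comment> \<open>As \<open>Im (cnj w) = - Im w\<close>, the numbers \<open>e * z\<close> and
    \<open>(e * Q - cnj e * P) * cnj R\<close> have equal imaginary parts; the phase
    \<open>e\<close> is chosen to make that part vanish.\<close>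
  define z where "z = Q * cnj R + cnj (P * cnj R)"
  define e where "e = (if z = 0 then 1 else cnj (sgn z))"
  have e: "cmod e = 1" by (simp add: e_def norm_sgn)
  have "e * z = of_real (cmod z)"
    by (simp add: e_def sgn_eq complex_norm_square[symmetric] power2_eq_square field_simps)
  then have "Im (e * z) = 0" by simp
  then have "Im ((e * Q - cnj e * P) * cnj R) = 0"
    by (simp add: z_def algebra_simps)
  then obtain s where s: "(e * Q - cnj e * P) * cnj R = of_real s"
    by (metis complex_is_Real_iff Reals_cases)
  define r where "r = s / (cmod R)\<^sup>2"
  have r: "e * Q - cnj e * P = of_real r * R"
  proof -
    have "(e * Q - cnj e * P) * (R * cnj R) = of_real s * R" using s by (simp add: algebra_simps)
    then show ?thesis using False
      by (simp add: r_def complex_norm_square[symmetric] field_simps)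
  qed
  text \<open>With \<open>a = cos x\<close> and \<open>b = e sin x\<close> it remains to solve \<open>r sin x cos x = - cos 2x\<close>.\<close>
  have "\<exists>x\<ge>0. x \<le> pi/2 \<and> r * (sin x * cos x) + ((cos x)\<^sup>2 - (sin x)\<^sup>2) = 0"
    by (rule IVT2') (auto intro!: continuous_intros)
  then obtain x where x: "r * (sin x * cos x) + ((cos x)\<^sup>2 - (sin x)\<^sup>2) = 0" by blast
  define c d where "c = complex_of_real (cos x)" and "d = complex_of_real (sin x)"
  have cd: "of_real r * (d * c) + (c\<^sup>2 - d\<^sup>2) = 0"
    using arg_cong[OF x, of complex_of_real] by (simp add: c_def d_def)
  have [simp]: "cnj c = c" "cnj d = d" by (simp_all add: c_def d_def)
  have ee: "e * cnj e = 1" using e by (simp add: complex_norm_square[symmetric])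
  show ?thesis
  proof (rule that[of c "e * d"])
    show "(cmod c)\<^sup>2 + (cmod (e * d))\<^sup>2 = 1"
      by (simp add: norm_mult e c_def d_def)
    have "- c * cnj (e * d) * P + (c * cnj c - (e * d) * cnj (e * d)) * R + (e * d) * cnj c * Q
        = d * c * (e * Q - cnj e * P) + (c\<^sup>2 - (e * cnj e) * d\<^sup>2) * R"
      by (simp add: algebra_simps power2_eq_square)
    also have "\<dots> = (of_real r * (d * c) + (c\<^sup>2 - d\<^sup>2)) * R"
      unfolding r ee by (simp add: algebra_simps)
    finally show "- c * cnj (e * d) * P + (c * cnj c - (e * d) * cnj (e * d)) * R
        + (e * d) * cnj c * Q = 0" by (simp add: cd)
  qed
qed

text \<open>The phase turns \<open>Q\<close> antiparallel to \<open>P\<close>. It occurs squared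
  because a rephased vector enters the quadratic form twice.\<close>

lemma exists_opposite_phase:
  fixes P Q :: complex
  obtains \<zeta> where "cmod \<zeta> = 1" "(cmod (P + \<zeta>\<^sup>2 * Q))\<^sup>2 = (cmod P - cmod Q)\<^sup>2"
proof -
  define p q where "p = (if P = 0 then 1 else sgn P)" and "q = (if Q = 0 then 1 else sgn Q)"
  have pq: "cmod p = 1" "cmod q = 1" "P = cmod P * p" "Q = cmod Q * q"
    by (auto simp: p_def q_def norm_divide sgn_eq)
  then have "q \<noteq> 0" by auto
  define \<zeta> where "\<zeta> = csqrt (- p / q)"
  have z2: "\<zeta>\<^sup>2 = - p / q" by (simp add: \<zeta>_def)
  then have "(cmod \<zeta>)\<^sup>2 = 1" by (simp add: pq(1,2) norm_divide flip: norm_power)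
  then have "cmod \<zeta> = 1" by (simp add: power2_eq_1_iff) (metis norm_ge_zero not_one_le_zero neg_0_le_iff_le)
  moreover have "P + \<zeta>\<^sup>2 * Q = of_real (cmod P - cmod Q) * p"
  proof -
    have "\<zeta>\<^sup>2 * Q = - (of_real (cmod Q) * p)"
      using \<open>q \<noteq> 0\<close> by (subst pq(4)) (simp add: z2)
    then show ?thesis by (subst pq(3)) (simp add: algebra_simps)
  qed
  then have "(cmod (P + \<zeta>\<^sup>2 * Q))\<^sup>2 = (cmod P - cmod Q)\<^sup>2"
    by (simp add: norm_mult pq(1) flip: of_real_diff)
  ultimately show thesis using that by blast
qed

text \<open>
  In a basis diagonalising the spin form, with diagonal entries \<open>P\<close> and \<open>Q\<close>, one decomposition has
  average \<open>\<bar>P\<bar> + \<bar>Q\<bar>\<close>; rotating by 45 degrees with opposite phases gives \<open>\<bar>\<bar>P\<bar> - \<bar>Q\<bar>\<bar>\<close>.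
\<close>
lemma reduced_concurrence_averages:
  fixes \<psi> :: "complex ^ (2 \<times> 2 \<times> 2)"
  assumes "norm \<psi> = 1"
  obtains a c where "a \<in> decomposition_averages concurrence_pure (ptrace_fst (proj \<psi>))"
    and "c \<in> decomposition_averages concurrence_pure (ptrace_fst (proj \<psi>))"
    and "0 \<le> c" "c \<le> a" "mu3 \<psi> = a\<^sup>2 - c\<^sup>2"
proof -
  define v w where "v = slice \<psi> 0" and "w = slice \<psi> 1"
  have sum2: "(\<Sum>i\<in>UNIV. g i) = g 0 + g 1" for g :: "2 \<Rightarrow> 'x::comm_monoid_add"
  proof -
    \<comment> \<open>\<open>sum_2\<close> enumerates the type as 1 and 2.\<close>
    have "(2 :: 2) = 0" by simp
    then show ?thesis by (simp only: sum_2 add.commute)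
  qed
  have \<sigma>: "ptrace_fst (proj \<psi>) = proj v + proj w"
    by (simp add: ptrace_fst_proj sum2 v_def w_def)
  have nrm: "(norm v)\<^sup>2 + (norm w)\<^sup>2 = 1"
    using sum_norm_slice[of \<psi>] assms by (simp add: sum2 v_def w_def)
  \<comment> \<open>Any unnormalised pair with the right projector sum is an ensemble of the reduced
    state; \<open>bool\<close> serves as the index set.\<close>
  have avg: "concurrence_pure x + concurrence_pure y
      \<in> decomposition_averages concurrence_pure (ptrace_fst (proj \<psi>))"
    if "proj x + proj y = proj v + proj w" for x y
  proof -
    have "(norm x)\<^sup>2 + (norm y)\<^sup>2 = 1"
      using sum_norm_proj_eq[of "\<lambda>b. if b then x else y" UNIV "\<lambda>b. if b then v else w" UNIV] that nrm
      by (simp add: UNIV_bool add.commute)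
    then show ?thesis
      using sum_in_decomposition_averages[of concurrence_pure UNIV "\<lambda>b. if b then x else y"]
      by (simp add: UNIV_bool concurrence_pure_scaleR \<sigma> that[symmetric] add.commute)
  qed
  obtain \<alpha> \<beta> where ab: "(cmod \<alpha>)\<^sup>2 + (cmod \<beta>)\<^sup>2 = 1" and
    diag: "- \<alpha> * cnj \<beta> * spin_form v v + (\<alpha> * cnj \<alpha> - \<beta> * cnj \<beta>) * spin_form v w
      + \<beta> * cnj \<alpha> * spin_form w w = 0"
    using takagi_2x2 by blast
  define x y where "x = \<alpha> *s v + \<beta> *s w" and "y = - cnj \<beta> *s v + cnj \<alpha> *s w"
  define P Q where "P = spin_form x x" and "Q = spin_form y y"
  have xy: "proj x + proj y = proj v + proj w"
    unfolding x_def y_def by (rule proj_unitary_mix[OF ab])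
  have off: "spin_form x y = 0"
    using diag unfolding x_def y_def spin_form_combine by (simp add: algebra_simps)
  have ab': "\<alpha> * cnj \<alpha> + \<beta> * cnj \<beta> = 1"
    using ab by (metis complex_norm_square of_real_1 of_real_add)
  \<comment> \<open>The Gram determinant scales by the squared determinant of the rotation, which is
    1; after diagonalisation it is just \<open>P * Q\<close>.\<close>
  have "P * Q - (spin_form x y)\<^sup>2
      = (\<alpha> * cnj \<alpha> + \<beta> * cnj \<beta>)\<^sup>2 * (spin_form v v * spin_form w w - (spin_form v w)\<^sup>2)"
    unfolding P_def Q_def x_def y_def spin_form_combine by algebra
  then have mu: "mu3 \<psi> = 4 * (cmod P * cmod Q)"
    unfolding mu3_eq_det v_def[symmetric] w_def[symmetric] by (simp add: off ab' flip: norm_mult)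
  obtain \<zeta> where z: "cmod \<zeta> = 1" "(cmod (P + \<zeta>\<^sup>2 * Q))\<^sup>2 = (cmod P - cmod Q)\<^sup>2"
    by (rule exists_opposite_phase)
  define h where "h = complex_of_real (1 / sqrt 2)"
  have hh: "h * h = 1/2" "cnj h = h" "cmod h ^ 2 = 1/2"
    by (simp_all add: h_def norm_divide power_divide flip: of_real_mult)
  define b where "b = h * \<zeta>"
  have hb: "(cmod h)\<^sup>2 + (cmod b)\<^sup>2 = 1" by (simp add: b_def norm_mult z(1) hh power_mult_distrib)
  define x' y' where "x' = h *s x + b *s y" and "y' = - cnj b *s x + cnj h *s y"
  have "proj x' + proj y' = proj v + proj w"
    unfolding x'_def y'_def proj_unitary_mix[OF hb] by (rule xy)
  have zz: "\<zeta> * cnj \<zeta> = 1" using z(1) by (simp add: complex_norm_square[symmetric])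
  have x'x': "spin_form x' x' = (P + \<zeta>\<^sup>2 * Q) / 2"
  proof -
    have "spin_form x' x' = (h * h) * (P + \<zeta>\<^sup>2 * Q)"
      unfolding x'_def spin_form_combine off P_def Q_def b_def
      by (simp add: algebra_simps power2_eq_square)
    then show ?thesis by (simp add: hh)
  qed
  \<comment> \<open>Both rotated vectors have the same concurrence, since their forms differ only by
    a phase.\<close>
  have y'y': "spin_form y' y' = (cnj \<zeta>)\<^sup>2 * ((P + \<zeta>\<^sup>2 * Q) / 2)"
  proof -
    have "spin_form y' y' = (h * h) * ((cnj \<zeta>)\<^sup>2 * P + Q)"
      unfolding y'_def spin_form_combine off P_def Q_def b_def
      by (simp add: algebra_simps power2_eq_square hh(2))
    also have "(cnj \<zeta>)\<^sup>2 * P + Q = (cnj \<zeta>)\<^sup>2 * P + (\<zeta> * cnj \<zeta>)\<^sup>2 * Q" by (simp add: zz)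
    also have "\<dots> = (cnj \<zeta>)\<^sup>2 * (P + \<zeta>\<^sup>2 * Q)" by algebra
    finally show ?thesis by (simp add: hh)
  qed
  have c: "concurrence_pure x' + concurrence_pure y' = cmod (P + \<zeta>\<^sup>2 * Q)"
    unfolding concurrence_pure_eq x'x' y'y' by (simp add: norm_mult norm_power norm_divide z(1))
  show thesis
  proof (rule that)
    show "cmod P + cmod Q \<in> decomposition_averages concurrence_pure (ptrace_fst (proj \<psi>))"
      using avg[OF xy] by (simp add: concurrence_pure_eq P_def Q_def)
    show "cmod (P + \<zeta>\<^sup>2 * Q) \<in> decomposition_averages concurrence_pure (ptrace_fst (proj \<psi>))"
      using avg[of x' y'] \<open>proj x' + proj y' = _\<close> c by simp
    show "0 \<le> cmod (P + \<zeta>\<^sup>2 * Q)" by simp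
    show "cmod (P + \<zeta>\<^sup>2 * Q) \<le> cmod P + cmod Q"
      using norm_triangle_ineq[of P "\<zeta>\<^sup>2 * Q"] by (simp add: norm_mult norm_power z(1))
    \<comment> \<open>The difference of the squared sum and the squared difference of two moduli is
      four times their product.\<close>
    show "mu3 \<psi> = (cmod P + cmod Q)\<^sup>2 - (cmod (P + \<zeta>\<^sup>2 * Q))\<^sup>2"
      unfolding z(2) mu by (simp add: power2_eq_square algebra_simps)
  qed
qed

section \<open>From pure three-qubit states to ensembles\<close>

text \<open>Factor each \<open>(a i)\<^sup>2 - (c i)\<^sup>2\<close> into difference times sum and
  apply Cauchy-Schwarz; the two resulting sums multiply back to a difference of squares.\<close>

lemma sum_sqrt_diff_squares_le:
  fixes p a c :: "'i \<Rightarrow> real"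
  assumes "\<And>i. i \<in> I \<Longrightarrow> 0 \<le> p i" "\<And>i. i \<in> I \<Longrightarrow> 0 \<le> c i" "\<And>i. i \<in> I \<Longrightarrow> c i \<le> a i"
  shows "(\<Sum>i\<in>I. p i * sqrt ((a i)\<^sup>2 - (c i)\<^sup>2))\<^sup>2
    \<le> (\<Sum>i\<in>I. p i * a i)\<^sup>2 - (\<Sum>i\<in>I. p i * c i)\<^sup>2"
proof -
  let ?x = "\<lambda>i. sqrt (p i * (a i - c i))" and ?y = "\<lambda>i. sqrt (p i * (a i + c i))"
  have "(\<Sum>i\<in>I. p i * sqrt ((a i)\<^sup>2 - (c i)\<^sup>2)) = (\<Sum>i\<in>I. ?x i * ?y i)"
  proof (rule sum.cong[OF refl])
    fix i assume "i \<in> I"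
    have "?x i * ?y i = sqrt ((p i)\<^sup>2 * ((a i)\<^sup>2 - (c i)\<^sup>2))"
      unfolding real_sqrt_mult[symmetric]
      by (rule arg_cong[where f = sqrt]) (simp add: power2_eq_square algebra_simps)
    then show "p i * sqrt ((a i)\<^sup>2 - (c i)\<^sup>2) = ?x i * ?y i"
      using assms(1)[OF \<open>i \<in> I\<close>] by (simp add: real_sqrt_mult)
  qed
  also have "\<dots>\<^sup>2 \<le> (\<Sum>i\<in>I. (?x i)\<^sup>2) * (\<Sum>i\<in>I. (?y i)\<^sup>2)"
    by (rule Cauchy_Schwarz_ineq_sum)
  also have "(\<Sum>i\<in>I. (?x i)\<^sup>2) = (\<Sum>i\<in>I. p i * (a i - c i))"
    using assms by (intro sum.cong) auto
  also have "(\<Sum>i\<in>I. (?y i)\<^sup>2) = (\<Sum>i\<in>I. p i * (a i + c i))"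
  proof (intro sum.cong refl real_sqrt_pow2 mult_nonneg_nonneg)
    fix i assume "i \<in> I"
    then show "0 \<le> p i" "0 \<le> a i + c i"
      using assms(1)[of i] assms(2)[of i] assms(3)[of i] by linarith+
  qed
  finally show ?thesis
    by (simp add: algebra_simps sum.distrib sum_subtractf power2_eq_square)
qed

text \<open>Each member supplies its two averages from \<open>reduced_concurrence_averages\<close>;
  by linearity of the partial trace, mixing them with the original weights gives averages for
  \<open>ptrace_fst \<rho>\<close>.\<close>

lemma average_tau3_le_concurrences:
  assumes t: "t \<in> decomposition_averages tau3_pure \<rho>"
  obtains a c where "a \<in> decomposition_averages concurrence_pure (ptrace_fst \<rho>)"
    and "c \<in> decomposition_averages concurrence_pure (ptrace_fst \<rho>)"
    and "t\<^sup>2 \<le> a\<^sup>2 - c\<^sup>2"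
proof -
  obtain m :: nat and p \<psi> where m: "\<forall>i<m. 0 \<le> p i \<and> norm (\<psi> i) = 1" "(\<Sum>i<m. p i) = 1"
      "\<rho> = (\<Sum>i<m. p i *\<^sub>R proj (\<psi> i))" "t = (\<Sum>i<m. p i * tau3_pure (\<psi> i))"
    using t by (rule decomposition_averagesE)
  have "\<forall>i\<in>{..<m}. \<exists>a c. a \<in> decomposition_averages concurrence_pure (ptrace_fst (proj (\<psi> i)))
    \<and> c \<in> decomposition_averages concurrence_pure (ptrace_fst (proj (\<psi> i)))
    \<and> 0 \<le> c \<and> c \<le> a \<and> mu3 (\<psi> i) = a\<^sup>2 - c\<^sup>2"
    using m(1) by (metis lessThan_iff reduced_concurrence_averages)
  then obtain a c where ac: "\<And>i. i \<in> {..<m} \<Longrightarrow>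
      a i \<in> decomposition_averages concurrence_pure (ptrace_fst (proj (\<psi> i)))
    \<and> c i \<in> decomposition_averages concurrence_pure (ptrace_fst (proj (\<psi> i)))
    \<and> 0 \<le> c i \<and> c i \<le> a i \<and> mu3 (\<psi> i) = (a i)\<^sup>2 - (c i)\<^sup>2"
    by metis
  have \<sigma>: "ptrace_fst \<rho> = (\<Sum>i<m. p i *\<^sub>R ptrace_fst (proj (\<psi> i)))"
    unfolding m(3) by (rule ptrace_fst_sum)
  have "t = (\<Sum>i<m. p i * sqrt ((a i)\<^sup>2 - (c i)\<^sup>2))"
    unfolding m(4) tau3_pure_def using ac by (intro sum.cong) auto
  then have "t\<^sup>2 \<le> (\<Sum>i<m. p i * a i)\<^sup>2 - (\<Sum>i<m. p i * c i)\<^sup>2"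
    using m(1) ac by (auto intro!: sum_sqrt_diff_squares_le)
  moreover have "(\<Sum>i<m. p i * a i) \<in> decomposition_averages concurrence_pure (ptrace_fst \<rho>)"
    unfolding \<sigma> using m ac by (intro decomposition_averages_mix) auto
  moreover have "(\<Sum>i<m. p i * c i) \<in> decomposition_averages concurrence_pure (ptrace_fst \<rho>)"
    unfolding \<sigma> using m ac by (intro decomposition_averages_mix) auto
  ultimately show thesis using that by blast
qed

theorem mainTheorem2:
  fixes \<phi> :: "complex ^ (2 \<times> 2 \<times> 2 \<times> 2)"
  assumes "norm \<phi> = 1"
  shows "(tau_A_BCD \<phi>)\<^sup>2 + (tau3 (rho_BCD \<phi>))\<^sup>2
           \<le> (concurrence_assist (rho_CD \<phi>))\<^sup>2 - (concurrence (rho_CD \<phi>))\<^sup>2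
       \<and> (concurrence_assist (rho_CD \<phi>))\<^sup>2 - (concurrence (rho_CD \<phi>))\<^sup>2
           = (tau3_AB_C_D \<phi>)\<^sup>2"
proof -
  let ?T = "decomposition_averages tau3_pure (rho_BCD \<phi>)"
  let ?C = "decomposition_averages concurrence_pure (rho_CD \<phi>)"
  have CD: "rho_CD \<phi> = ptrace_fst (rho_BCD \<phi>)"
    by (simp add: rho_CD_def rho_BCD_def)
  \<comment> \<open>The slices of \<open>\<phi>\<close> along A form an explicit ensemble of
    \<open>rho_BCD \<phi>\<close>.\<close>
  have T: "?T \<noteq> {}"
    unfolding rho_BCD_def ptrace_fst_proj
    using sum_in_decomposition_averages[of tau3_pure UNIV "slice \<phi>"] sum_norm_slice[of \<phi>] assms
    by (auto simp: tau3_pure_scaleR)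
  have tau_bounds: "tau_assist (rho_BCD \<phi>) \<in> ?T" "tau3 (rho_BCD \<phi>) \<le> tau_assist (rho_BCD \<phi>)"
    "0 \<le> tau3 (rho_BCD \<phi>)"
    unfolding tau_assist_def tau3_def
    using roof_min_attained[OF continuous_on_tau3_pure T] roof_max_attained[OF continuous_on_tau3_pure T]
    by (auto intro: decomposition_averages_nonneg[rotated] simp: tau3_pure_def mu3_nonneg)
  obtain a c where ac: "a \<in> ?C" "c \<in> ?C" "(tau_assist (rho_BCD \<phi>))\<^sup>2 \<le> a\<^sup>2 - c\<^sup>2"
    using average_tau3_le_concurrences[OF tau_bounds(1)] unfolding CD by blast
  then have C: "?C \<noteq> {}" by blast
  have nonneg: "0 \<le> s" if "s \<in> ?C" for s
    using that by (rule decomposition_averages_nonneg[rotated]) (simp add: concurrence_pure_eq)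
  note cmin = roof_min_attained[OF continuous_on_concurrence_pure C, folded concurrence_def]
  note cmax = roof_max_attained[OF continuous_on_concurrence_pure C, folded concurrence_assist_def]
  have "a\<^sup>2 \<le> (concurrence_assist (rho_CD \<phi>))\<^sup>2" "(concurrence (rho_CD \<phi>))\<^sup>2 \<le> c\<^sup>2"
    using ac cmin cmax nonneg by (auto intro!: power_mono)
  \<comment> \<open>The radicand is nonnegative because the minimum is at most the maximum, so the
    left side collapses to the squared tangle of assistance.\<close>
  moreover have "(tau_A_BCD \<phi>)\<^sup>2 + (tau3 (rho_BCD \<phi>))\<^sup>2 = (tau_assist (rho_BCD \<phi>))\<^sup>2"
    unfolding tau_A_BCD_def using tau_bounds by (simp add: power_mono)
  \<comment> \<open>This makes the radicand of \<open>tau3_AB_C_D\<close> nonnegative, which yields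
    the claimed equality.\<close>
  moreover have "(concurrence (rho_CD \<phi>))\<^sup>2 \<le> (concurrence_assist (rho_CD \<phi>))\<^sup>2"
    using cmin cmax nonneg by (intro power_mono) auto
  ultimately show ?thesis
    unfolding tau3_AB_C_D_def using ac(3) by auto
qed

end
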